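(* Suppose that either (JS) $\tau$ is the jittered sampling and $\alpha=1$, or (RS) $\tau$ is the renewal sampling and $\alpha\in(0,1)$ is fixed (thought of as close to $1$). For $N\ge1$ let $N_\alpha=[\alpha N]$ and $$A_N=\frac1N\sum_{i=0}^{N_\alpha-1}\tau_{i+1}\left(W_{\tau_{i+1}}-W_{\tau_i}\right).$$ Then $$\mathbb{E}\left|N A_N\right|^2\longrightarrow \frac{1}{3}\alpha^3\qquad\text{as } N\to\infty.$$
   Context: $W=(W_t)_{t\ge 0}$ is a standard Brownian motion and, for each $N\ge1$, the random times $\tau_i=\tau_{i,N}$ are independent of $W$, with $\tau_0=0$. $[x]$ denotes the integer part of $x$. Jittered sampling (JS): $\tau_i=\tau_{i,N}=\frac{i}{N}+\nu_{i,N}$ for $i=1,\dots,N$, and $\tau_0=0$, where for each $N$ the variables $\nu_{i,N}$, $1\le i\le N$, are independent and identically distributed with a density $g_N$ that is symmetric (about $0$) and supported in $[-\frac{1}{2N},\frac{1}{2N}]$, with $\mathbb{E}[\nu_{i,N}]=0$ and $\mathbb{E}[\nu_{i,N}^2]=c_1/N^2$ for a constant $c_1>0$ not depending on $i$ or $N$. Renewal sampling (RS): $\tau_i=\tau_{i,N}=\sum_{j=1}^i t_j$ for $i\ge1$, and $\tau_0=0$, where for each $N$ the variables $t_j=t_{j,N}$ are independent and identically distributed, exponential with parameter $N$ (density $Ne^{-Nt}1_{(0,\infty)}(t)$). *)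

theory Defs
  imports "HOL-Probability.Probability"
begin

text \<open>
  Only the values \<open>W t\<close> with \<open>t \<ge> 0\<close> are constrained. All paths are continuous (not just almost
  all), so that \<open>W\<close> evaluated at a random time is measurable on any probability space,
  complete or not.
\<close>

definition standard_brownian_motion :: "'a measure \<Rightarrow> (real \<Rightarrow> 'a \<Rightarrow> real) \<Rightarrow> bool" where
  "standard_brownian_motion M W \<longleftrightarrow>
     prob_space M \<and>
     (\<forall>t\<ge>0. W t \<in> borel_measurable M) \<and>
     (AE \<omega> in M. W 0 \<omega> = 0) \<and>
     (\<forall>s t. 0 \<le> s \<and> s < t \<longrightarrow>
        distributed M lborel (\<lambda>\<omega>. W t \<omega> - W s \<omega>)
          (\<lambda>x. ennreal (normal_density 0 (sqrt (t - s)) x))) \<and>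
     (\<forall>(T :: nat \<Rightarrow> real) n. 0 \<le> T 0 \<and> (\<forall>k<n. T k < T (Suc k)) \<longrightarrow>
        prob_space.indep_vars M (\<lambda>_. borel) (\<lambda>k \<omega>. W (T (Suc k)) \<omega> - W (T k) \<omega>) {..<n}) \<and>
     (\<forall>\<omega>\<in>space M. continuous_on {0..} (\<lambda>t. W t \<omega>))"

text \<open>
  Random times \<open>\<tau> i\<close> (\<open>i \<in> I\<close>) take values in \<open>[0, \<infinity>)\<close>, the index set of \<open>W\<close>, at every sample
  point. The process \<open>W\<close> and the family of times are independent as random elements of the
  respective product spaces, which is independence of the sigma-algebras they generate.
\<close>

definition independent_random_times ::
  "'a measure \<Rightarrow> (real \<Rightarrow> 'a \<Rightarrow> real) \<Rightarrow> nat set \<Rightarrow> (nat \<Rightarrow> 'a \<Rightarrow> real) \<Rightarrow> bool" where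
  "independent_random_times M W I \<tau> \<longleftrightarrow>
     (\<forall>i\<in>I. \<tau> i \<in> borel_measurable M \<and> (\<forall>\<omega>\<in>space M. 0 \<le> \<tau> i \<omega>)) \<and>
     prob_space.indep_var M
       (PiM {0..} (\<lambda>_. borel)) (\<lambda>\<omega>. \<lambda>t\<in>{0..}. W t \<omega>)
       (PiM I (\<lambda>_. borel)) (\<lambda>\<omega>. \<lambda>i\<in>I. \<tau> i \<omega>)"

text \<open>
  In both schemes \<open>\<tau> N i\<close> stands for \<open>\<tau>\<^sub>i\<^sub>,\<^sub>N\<close>. No relation is required between different \<open>N\<close>,
  except that the constant \<open>c\<^sub>1\<close> in the jittered scheme is common to all of them. The jittered
  times are only defined for \<open>i \<le> N\<close>.
\<close>

definition jittered_sampling ::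
  "'a measure \<Rightarrow> (real \<Rightarrow> 'a \<Rightarrow> real) \<Rightarrow> (nat \<Rightarrow> nat \<Rightarrow> 'a \<Rightarrow> real) \<Rightarrow> bool" where
  "jittered_sampling M W \<tau> \<longleftrightarrow>
     (\<exists>c\<^sub>1>0. \<forall>N\<ge>1.
        independent_random_times M W {..N} (\<tau> N) \<and>
        (\<forall>\<omega>\<in>space M. \<tau> N 0 \<omega> = 0) \<and>
        (\<exists>(\<nu> :: nat \<Rightarrow> 'a \<Rightarrow> real) (g :: real \<Rightarrow> real).
           (\<forall>x. 0 \<le> g x) \<and>
           (\<forall>x. g (- x) = g x) \<and>
           (\<forall>x. x \<notin> {- 1 / (2 * real N) .. 1 / (2 * real N)} \<longrightarrow> g x = 0) \<and>
           prob_space.indep_vars M (\<lambda>_. borel) \<nu> {1..N} \<and>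
           (\<forall>i\<in>{1..N}.
              distributed M lborel (\<nu> i) (\<lambda>x. ennreal (g x)) \<and>
              prob_space.expectation M (\<nu> i) = 0 \<and>
              prob_space.expectation M (\<lambda>\<omega>. (\<nu> i \<omega>)\<^sup>2) = c\<^sub>1 / (real N)\<^sup>2 \<and>
              (\<forall>\<omega>\<in>space M. \<tau> N i \<omega> = real i / real N + \<nu> i \<omega>))))"

definition renewal_sampling ::
  "'a measure \<Rightarrow> (real \<Rightarrow> 'a \<Rightarrow> real) \<Rightarrow> (nat \<Rightarrow> nat \<Rightarrow> 'a \<Rightarrow> real) \<Rightarrow> bool" where
  "renewal_sampling M W \<tau> \<longleftrightarrow>
     (\<forall>N\<ge>1.
        independent_random_times M W UNIV (\<tau> N) \<and>
        (\<exists>t :: nat \<Rightarrow> 'a \<Rightarrow> real.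
           prob_space.indep_vars M (\<lambda>_. borel) t {1..} \<and>
           (\<forall>j\<ge>1. distributed M lborel (t j) (\<lambda>x. ennreal (exponential_density (real N) x))) \<and>
           (\<forall>i. \<forall>\<omega>\<in>space M. \<tau> N i \<omega> = (\<Sum>j=1..i. t j \<omega>))))"

definition sampled_sum ::
  "(real \<Rightarrow> 'a \<Rightarrow> real) \<Rightarrow> (nat \<Rightarrow> nat \<Rightarrow> 'a \<Rightarrow> real) \<Rightarrow> real \<Rightarrow> nat \<Rightarrow> 'a \<Rightarrow> real" where
  "sampled_sum W \<tau> \<alpha> N \<omega> =
     1 / real N *
       (\<Sum>i<nat \<lfloor>\<alpha> * real N\<rfloor>.
          \<tau> N (Suc i) \<omega> * (W (\<tau> N (Suc i) \<omega>) \<omega> - W (\<tau> N i \<omega>) \<omega>))"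

end

(* Summation by parts turns the sum into tau_n W(tau_n) minus a Riemann sum of the path, so along times
   whose mesh vanishes and whose endpoint tends to a, it converges path by path to
   Z = a W(a) - int_0^a W(t) dt. Chaining gives |W(t)| <= H (1 + t) with H in L^4, and the moments of
   tau_n converge to powers of a. Together these give enough domination to conclude that the second
   moments converge to E Z^2, along subsequences on which the convergence of mesh and endpoint is almost
   sure. The deterministic grid i/N is one admissible choice of times, and there independence of the
   increments gives the second moment exactly, hence E Z^2 = a^3/3. *)

theory Submission
  imports Defs
begin

text \<open>Z is the Wiener integral of t over [0, a], and a^3/3 is the integral of t^2, as in the
  Ito isometry. Since the integrand is smooth, integration by parts makes Z an ordinary functional
  of the path, so convergence can be proved path by path for any times that fill [0, a]. The
  obstacle is integrability: \<open>W\<close> is evaluated at times that are random and, in renewal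
  sampling, unbounded. A bound H (1 + t) valid for all t at once separates path from time: the sum
  is at most 2 H \<tau>_n (1 + \<tau>_n), and 2xy \<le> x^2 + y^2 splits its square into H^4 and a
  polynomial in \<tau>_n. This is why H has to lie in L^4, and why the end point is controlled
  through its moments, which can be computed or squeezed in both schemes.\<close>

section \<open>Measurability at random times and Gaussian moments\<close>

text \<open>Joint measurability makes \<open>W\<close> at a random time a random variable. Rounding
  the time down to a grid leaves countably many values, and continuity of the paths removes the
  rounding in the limit. \<open>max 0\<close> clips the time to the index set of the
  process.\<close>

lemma borel_measurable_continuous_process:
  fixes W :: "real \<Rightarrow> 'a \<Rightarrow> real"
  assumes [measurable]: "\<And>t. 0 \<le> t \<Longrightarrow> W t \<in> borel_measurable A"
    and cont: "\<And>\<omega>. \<omega> \<in> space A \<Longrightarrow> continuous_on {0..} (\<lambda>t. W t \<omega>)"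
  shows "(\<lambda>(\<omega>, s). W (max 0 s) \<omega>) \<in> borel_measurable (A \<Otimes>\<^sub>M borel)"
proof (rule borel_measurable_LIMSEQ_real)
  let ?a = "\<lambda>n s. real (nat \<lfloor>s * real (Suc n)\<rfloor>) / real (Suc n)"
  fix n
  have "(\<lambda>x. W (real k / real (Suc n)) (fst x)) \<in> borel_measurable (A \<Otimes>\<^sub>M borel)" for k
    by measurable
  then show "(\<lambda>x. W (?a n (snd x)) (fst x)) \<in> borel_measurable (A \<Otimes>\<^sub>M borel)"
    by (rule measurable_compose_countable) measurable
next
  let ?a = "\<lambda>n s. real (nat \<lfloor>s * real (Suc n)\<rfloor>) / real (Suc n)"
  fix x :: "'a \<times> real" assume x: "x \<in> space (A \<Otimes>\<^sub>M borel)"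
  obtain \<omega> s where [simp]: "x = (\<omega>, s)" by force
  have \<omega>: "\<omega> \<in> space A" using x by (simp add: space_pair_measure)
  have "(\<lambda>n. ?a n s) \<longlonglongrightarrow> max 0 s"
  proof (rule Lim_null_comparison[THEN LIM_zero_cancel])
    show "\<forall>\<^sub>F n in sequentially. norm (?a n s - max 0 s) \<le> inverse (real (Suc n))"
    proof (rule always_eventually, rule)
      fix n
      \<comment> \<open>\<open>nat\<close> sends negative integers to 0, so for y < 0 the rounded
        value equals \<open>max 0 y\<close> and one estimate covers both signs.\<close>
      have *: "real (nat \<lfloor>y\<rfloor>) \<le> max 0 y \<and> max 0 y \<le> real (nat \<lfloor>y\<rfloor>) + 1" for y :: real
      proof (cases "0 \<le> y")
        case True
        then have "real (nat \<lfloor>y\<rfloor>) = of_int \<lfloor>y\<rfloor>" by simp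
        with True show ?thesis by linarith
      qed simp
      have m: "max 0 (s * real (Suc n)) = max 0 s * real (Suc n)"
        by (auto simp: max_def mult_le_0_iff zero_le_mult_iff)
      have "?a n s \<le> max 0 s" "max 0 s \<le> ?a n s + inverse (real (Suc n))"
        using *[of "s * real (Suc n)"] unfolding m
        by (simp_all only: inverse_eq_divide add_divide_distrib[symmetric] pos_divide_le_eq pos_le_divide_eq of_nat_0_less_iff zero_less_Suc)
      then show "norm (?a n s - max 0 s) \<le> inverse (real (Suc n))"
        unfolding real_norm_def abs_le_iff by linarith
    qed
    show "(\<lambda>n. inverse (real (Suc n))) \<longlonglongrightarrow> 0" by (rule LIMSEQ_inverse_real_of_nat)
  qed
  then have "(\<lambda>n. W (?a n s) \<omega>) \<longlonglongrightarrow> W (max 0 s) \<omega>"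
    by (intro continuous_on_tendsto_compose[OF cont[OF \<omega>]]) auto
  then show "(\<lambda>n. W (?a n (snd x)) (fst x)) \<longlonglongrightarrow> (case x of (\<omega>, s) \<Rightarrow> W (max 0 s) \<omega>)"
    by simp
qed

text \<open>The constant is (2k - 1)!! \<sigma>^(2k). The cases k = 1 and k = 2 give the variance of
  weighted sums and the fourth moment of increments.\<close>

lemma (in prob_space) normal_distributed_nn_even_moment:
  fixes \<sigma> :: real
  assumes \<sigma>: "0 < \<sigma>" and D: "distributed M lborel X (normal_density 0 \<sigma>)"
  shows "(\<integral>\<^sup>+\<omega>. ennreal (X \<omega> ^ (2 * k)) \<partial>M) = ennreal (fact (2 * k) / ((2 / \<sigma>\<^sup>2) ^ k * fact k))"
proof -
  have "has_bochner_integral lborel (\<lambda>x. normal_density 0 \<sigma> x * x ^ (2 * k))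
      (fact (2 * k) / ((2 / \<sigma>\<^sup>2) ^ k * fact k))"
    using normal_moment_even[OF \<sigma>, of 0 k] by simp
  then have "(\<integral>\<^sup>+x. ennreal (normal_density 0 \<sigma> x * x ^ (2 * k)) \<partial>lborel)
      = ennreal (fact (2 * k) / ((2 / \<sigma>\<^sup>2) ^ k * fact k))"
    by (subst nn_integral_eq_integral) (auto simp: has_bochner_integral_iff zero_le_even_power)
  moreover have "(\<integral>\<^sup>+\<omega>. ennreal (X \<omega> ^ (2 * k)) \<partial>M)
      = (\<integral>\<^sup>+x. ennreal (normal_density 0 \<sigma> x) * ennreal (x ^ (2 * k)) \<partial>lborel)"
    by (rule distributed_nn_integral[OF D, symmetric]) simp
  ultimately show ?thesis by (simp add: ennreal_mult')
qed

text \<open>A sum of independent centred normals is normal with the summed variance. Positive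
  weights and strictly increasing times keep each summand nondegenerate, so that it has a density;
  the empty sum has none and is split off.\<close>

lemma brownian_weighted_increments_second_moment:
  fixes T c :: "nat \<Rightarrow> real"
  assumes W: "standard_brownian_motion M W"
    and T: "0 \<le> T 0" "\<And>i. i < n \<Longrightarrow> T i < T (Suc i)"
    and c: "\<And>i. i < n \<Longrightarrow> 0 < c i"
  shows "(\<integral>\<^sup>+\<omega>. ennreal ((\<Sum>i<n. c i * (W (T (Suc i)) \<omega> - W (T i) \<omega>))\<^sup>2) \<partial>M)
    = ennreal (\<Sum>i<n. (c i)\<^sup>2 * (T (Suc i) - T i))"
proof (cases "n = 0")
  case False
  interpret prob_space M using W by (simp add: standard_brownian_motion_def)
  have T_nonneg: "i \<le> n \<Longrightarrow> 0 \<le> T i" for i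
    by (induction i) (use T(1) in simp, use T(2) in \<open>force dest: Suc_le_lessD\<close>)
  let ?X = "\<lambda>i \<omega>. c i * (W (T (Suc i)) \<omega> - W (T i) \<omega>)"
  have "indep_vars (\<lambda>_. borel) (\<lambda>i \<omega>. W (T (Suc i)) \<omega> - W (T i) \<omega>) {..<n}"
    using W T by (auto simp: standard_brownian_motion_def)
  then have indep: "indep_vars (\<lambda>_. borel) ?X {..<n}"
    by (rule indep_vars_compose2) simp
  have dist: "distributed M lborel (?X i) (normal_density 0 (c i * sqrt (T (Suc i) - T i)))" if "i < n" for i
  proof -
    have "distributed M lborel (\<lambda>\<omega>. W (T (Suc i)) \<omega> - W (T i) \<omega>) (normal_density 0 (sqrt (T (Suc i) - T i)))"
      using W T that T_nonneg[of i] by (auto simp: standard_brownian_motion_def)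
    from normal_density_affine[OF this, of "c i" 0] show ?thesis
      using T(2)[OF that] c[OF that] by simp
  qed
  have D: "distributed M lborel (\<lambda>\<omega>. \<Sum>i<n. ?X i \<omega>)
      (normal_density 0 (sqrt (\<Sum>i<n. (c i * sqrt (T (Suc i) - T i))\<^sup>2)))"
    using sum_indep_normal[OF _ _ indep, of "\<lambda>i. c i * sqrt (T (Suc i) - T i)" "\<lambda>_. 0"] dist T c False
    by auto
  have S: "(\<Sum>i<n. (c i * sqrt (T (Suc i) - T i))\<^sup>2) = (\<Sum>i<n. (c i)\<^sup>2 * (T (Suc i) - T i))"
    by (intro sum.cong) (auto simp: power_mult_distrib T less_imp_le)
  have pos: "0 < (\<Sum>i<n. (c i)\<^sup>2 * (T (Suc i) - T i))"
    using T(2) c False by (intro sum_pos) fastforce+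
  then have "0 < sqrt (\<Sum>i<n. (c i)\<^sup>2 * (T (Suc i) - T i))"
    by (simp only: real_sqrt_gt_0_iff)
  from normal_distributed_nn_even_moment[OF this D[unfolded S], of 1] show ?thesis
    using pos by (simp add: less_imp_le)
qed simp

section \<open>Sums along partitions of the time axis\<close>

text \<open>Moves the differences from f, which along a Brownian path has unbounded variation, onto
  the partition points, so that continuity of f suffices for a limit.\<close>

lemma summation_by_parts_partition:
  fixes f s :: "_ \<Rightarrow> real"
  shows "(\<Sum>i<n. s (Suc i) * (f (s (Suc i)) - f (s i)))
    = s n * f (s n) - s 0 * f (s 0) - (\<Sum>i<n. f (s i) * (s (Suc i) - s i))"
  by (induction n) (simp_all add: algebra_simps)

lemma partition_mono:
  fixes s :: "nat \<Rightarrow> real"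
  assumes "\<And>i. i < n \<Longrightarrow> s i \<le> s (Suc i)" "i \<le> j" "j \<le> n"
  shows "s i \<le> s j"
  using assms(2,3)
proof (induction j rule: dec_induct)
  case (step m)
  with assms(1)[of m] show ?case by auto
qed simp

text \<open>After summation by parts the steps telescope, so the bound depends on the partition only
  through its end point and not on the number of steps.\<close>

lemma partition_sum_bound:
  fixes f :: "real \<Rightarrow> real" and s :: "nat \<Rightarrow> real"
  assumes s0: "s 0 = 0" and mono: "\<And>i. i < n \<Longrightarrow> s i \<le> s (Suc i)"
    and f: "\<And>t. 0 \<le> t \<Longrightarrow> \<bar>f t\<bar> \<le> H * (1 + t)" and H: "0 \<le> H"
  shows "\<bar>\<Sum>i<n. s (Suc i) * (f (s (Suc i)) - f (s i))\<bar> \<le> 2 * H * s n * (1 + s n)"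
proof -
  have le: "0 \<le> s i \<and> s i \<le> s n" if "i \<le> n" for i
    using partition_mono[of n s 0 i, OF mono] partition_mono[of n s i n, OF mono] s0 that by simp
  have fb: "\<bar>f (s i)\<bar> \<le> H * (1 + s n)" if "i \<le> n" for i
    using le[OF that] f[of "s i"] H mult_left_mono[of "1 + s i" "1 + s n" H] by force
  have "\<bar>\<Sum>i<n. f (s i) * (s (Suc i) - s i)\<bar> \<le> (\<Sum>i<n. H * (1 + s n) * (s (Suc i) - s i))"
    using fb mono by (intro order_trans[OF sum_abs] sum_mono) (auto simp: abs_mult intro!: mult_right_mono)
  also have "\<dots> = H * (1 + s n) * s n"
    by (simp only: sum_distrib_left[symmetric] sum_lessThan_telescope s0) simp
  finally have "\<bar>\<Sum>i<n. f (s i) * (s (Suc i) - s i)\<bar> \<le> H * (1 + s n) * s n" .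
  moreover have "\<bar>s n * f (s n)\<bar> \<le> s n * (H * (1 + s n))"
    using le[of n] fb[of n] by (auto simp: abs_mult intro!: mult_left_mono)
  ultimately show ?thesis
    unfolding summation_by_parts_partition s0 by (auto simp: algebra_simps)
qed

lemma riemann_sum_error:
  fixes f :: "real \<Rightarrow> real" and s :: "nat \<Rightarrow> real"
  assumes s0: "s 0 = 0" and mono: "\<And>i. i < n \<Longrightarrow> s i \<le> s (Suc i)"
    and cont: "continuous_on {0..s n} f"
    and osc: "\<And>i t. i < n \<Longrightarrow> s i \<le> t \<Longrightarrow> t \<le> s (Suc i) \<Longrightarrow> \<bar>f t - f (s i)\<bar> \<le> e"
    and "m \<le> n"
  shows "\<bar>integral {0..s m} f - (\<Sum>i<m. f (s i) * (s (Suc i) - s i))\<bar> \<le> e * s m"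
  using \<open>m \<le> n\<close>
proof (induction m)
  case (Suc m)
  then have m: "m < n" by simp
  have le: "0 \<le> s m" "s m \<le> s (Suc m)" "s (Suc m) \<le> s n"
    using partition_mono[of n s 0 m, OF mono] mono[OF m] partition_mono[of n s "Suc m" n, OF mono] s0 Suc
    by simp_all
  have int: "f integrable_on {u..v}" if "0 \<le> u" "v \<le> s n" for u v
    by (intro integrable_continuous_interval continuous_on_subset[OF cont]) (use that in auto)
  have "integral {0..s (Suc m)} f = integral {0..s m} f + integral {s m..s (Suc m)} f"
    using le int by (intro Henstock_Kurzweil_Integration.integral_combine[symmetric]) auto
  moreover have "\<bar>integral {s m..s (Suc m)} f - f (s m) * (s (Suc m) - s m)\<bar> \<le> e * (s (Suc m) - s m)"
  proof -
    have "integral {s m..s (Suc m)} (\<lambda>t. f t - f (s m))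
        = integral {s m..s (Suc m)} f - integral {s m..s (Suc m)} (\<lambda>t. f (s m))"
      using le by (intro Henstock_Kurzweil_Integration.integral_diff int) auto
    moreover have "norm (integral {s m..s (Suc m)} (\<lambda>t. f t - f (s m))) \<le> e * (s (Suc m) - s m)"
      using le osc[OF m]
      by (intro integral_bound) (auto intro!: continuous_intros continuous_on_subset[OF cont])
    ultimately show ?thesis using le by (simp add: mult.commute)
  qed
  ultimately show ?case using Suc m by (auto simp: algebra_simps abs_le_iff)
qed (simp add: s0)

text \<open>The mesh is measured by the sum of squared steps because its expectation is easy to
  handle for random times. Each squared step is at most this sum, so it controls the largest step,
  as uniform continuity requires.\<close>

lemma integration_by_parts_partition_limit:
  fixes f :: "real \<Rightarrow> real" and s :: "nat \<Rightarrow> nat \<Rightarrow> real"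
  assumes cont: "continuous_on {0..} f"
    and s0: "\<And>N. s N 0 = 0" and mono: "\<And>N i. i < n N \<Longrightarrow> s N i \<le> s N (Suc i)"
    and end_lim: "(\<lambda>N. s N (n N)) \<longlonglongrightarrow> a"
    and mesh: "(\<lambda>N. \<Sum>i<n N. (s N (Suc i) - s N i)\<^sup>2) \<longlonglongrightarrow> 0"
  shows "(\<lambda>N. \<Sum>i<n N. s N (Suc i) * (f (s N (Suc i)) - f (s N i)))
    \<longlonglongrightarrow> a * f a - integral {0..a} f"
proof -
  have nonneg: "0 \<le> s N (n N)" for N
    using partition_mono[of "n N" "s N" 0 "n N", OF mono] s0[of N] by simp
  then have a: "0 \<le> a" by (intro LIMSEQ_le_const[OF end_lim]) auto
  have end_b: "\<forall>\<^sub>F N in sequentially. s N (n N) < a + 1"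
    using end_lim by (rule order_tendstoD) simp
  have f_lim: "(\<lambda>N. f (s N (n N))) \<longlonglongrightarrow> f a"
    by (rule continuous_on_tendsto_compose[OF cont end_lim]) (use a nonneg in auto)
  have "continuous_on {0..a + 1} (\<lambda>x. integral {0..x} f)"
    by (intro indefinite_integral_continuous_1 integrable_continuous_interval continuous_on_subset[OF cont]) auto
  then have int_lim: "(\<lambda>N. integral {0..s N (n N)} f) \<longlonglongrightarrow> integral {0..a} f"
    by (rule continuous_on_tendsto_compose[OF _ end_lim])
       (use a nonneg end_b in \<open>auto elim!: eventually_mono\<close>)
  have "(\<lambda>N. integral {0..s N (n N)} f - (\<Sum>i<n N. f (s N i) * (s N (Suc i) - s N i))) \<longlonglongrightarrow> 0"
  proof (rule LIMSEQ_I)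
    fix r :: real assume r: "0 < r"
    \<comment> \<open>The end point may overshoot a, but is below a + 1 for large N; the factor 2
      leaves r / 2 < r.\<close>
    define e where "e = r / (2 * (a + 1))"
    have e: "0 < e" using r a by (simp add: e_def)
    have "uniformly_continuous_on {0..a + 1} f"
      by (intro compact_uniformly_continuous continuous_on_subset[OF cont]) auto
    then obtain d where d: "0 < d"
      and osc: "\<And>x y. x \<in> {0..a+1} \<Longrightarrow> y \<in> {0..a+1} \<Longrightarrow> dist y x < d \<Longrightarrow> dist (f y) (f x) < e"
      using e unfolding uniformly_continuous_on_def by blast
    have "\<forall>\<^sub>F N in sequentially. (\<Sum>i<n N. (s N (Suc i) - s N i)\<^sup>2) < d\<^sup>2"
      using mesh by (rule order_tendstoD) (use d in simp)
    with end_b have "\<forall>\<^sub>F N in sequentially.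
        norm (integral {0..s N (n N)} f - (\<Sum>i<n N. f (s N i) * (s N (Suc i) - s N i)) - 0) < r"
    proof eventually_elim
      case (elim N)
      have small: "s N (Suc i) - s N i < d" if "i < n N" for i
      proof (rule power2_less_imp_less)
        have "(s N (Suc i) - s N i)\<^sup>2 \<le> (\<Sum>i<n N. (s N (Suc i) - s N i)\<^sup>2)"
          using that by (intro member_le_sum) auto
        then show "(s N (Suc i) - s N i)\<^sup>2 < d\<^sup>2" using elim by simp
      qed (use d in simp)
      have "\<bar>integral {0..s N (n N)} f - (\<Sum>i<n N. f (s N i) * (s N (Suc i) - s N i))\<bar> \<le> e * s N (n N)"
      proof (rule riemann_sum_error[OF s0 mono])
        fix i t assume i: "i < n N" and t: "s N i \<le> t" "t \<le> s N (Suc i)"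
        have "0 \<le> s N i" "s N (Suc i) \<le> s N (n N)"
          using partition_mono[of "n N" "s N" 0 i, OF mono] partition_mono[of "n N" "s N" "Suc i" "n N", OF mono]
            s0[of N] i by simp_all
        then have "dist (f t) (f (s N i)) < e"
          using t elim small[OF i] by (intro osc) (auto simp: dist_real_def)
        then show "\<bar>f t - f (s N i)\<bar> \<le> e" by (simp add: dist_real_def)
      qed (auto intro: continuous_on_subset[OF cont])
      also have "\<dots> \<le> e * (a + 1)"
        using elim e by (intro mult_left_mono) auto
      also have "\<dots> < r"
        using r a by (simp add: e_def field_simps add_pos_nonneg)
      finally show ?case by simp
    qed
    then show "\<exists>N0. \<forall>N\<ge>N0. norm (integral {0..s N (n N)} f
        - (\<Sum>i<n N. f (s N i) * (s N (Suc i) - s N i)) - 0) < r"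
      by (simp add: eventually_sequentially)
  qed
  moreover have parts: "(\<Sum>i<n N. s N (Suc i) * (f (s N (Suc i)) - f (s N i)))
      = s N (n N) * f (s N (n N)) - integral {0..s N (n N)} f
        + (integral {0..s N (n N)} f - (\<Sum>i<n N. f (s N i) * (s N (Suc i) - s N i)))" for N
    by (subst summation_by_parts_partition) (simp only: s0 mult_zero_left diff_0_right diff_add_cancel add_diff_eq)
  ultimately show ?thesis
    using tendsto_add[OF tendsto_diff[OF tendsto_mult[OF end_lim f_lim] int_lim], of _ 0]
    by (simp only: parts add_0_right)
qed

section \<open>Chaining and growth of Brownian paths\<close>

text \<open>A dyadic point of level m + 1 either belongs to level m or lies one step to the right of
  such a point. Descending to level 0 thus costs at most one increment per level, a geometric series
  in total, and continuity extends the bound to all t.\<close>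

lemma dyadic_chaining:
  fixes f :: "real \<Rightarrow> real"
  assumes T: "0 \<le> T" and cont: "continuous_on {0..T} f" and q: "0 \<le> q" "q < 1" and C: "0 \<le> C"
    and inc: "\<And>m j. j < 2 ^ m \<Longrightarrow>
      \<bar>f (T * real (Suc j) / 2 ^ m) - f (T * real j / 2 ^ m)\<bar> \<le> C * q ^ m"
    and t: "t \<in> {0..T}"
  shows "\<bar>f t - f 0\<bar> \<le> C / (1 - q)"
proof -
  have dyadic: "j \<le> 2 ^ m \<Longrightarrow> \<bar>f (T * real j / 2 ^ m) - f 0\<bar> \<le> (\<Sum>l\<le>m. C * q ^ l)" for j m
  proof (induction m arbitrary: j)
    case 0
    then have "j = 0 \<or> j = 1" by auto
    with inc[of 0 0] C show ?case by auto
  next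
    case (Suc m)
    show ?case
    proof (cases "even j")
      case True
      then obtain k where k: "j = 2 * k" by auto
      then have "T * real j / 2 ^ Suc m = T * real k / 2 ^ m" by simp
      moreover have "\<bar>f (T * real k / 2 ^ m) - f 0\<bar> \<le> (\<Sum>l\<le>m. C * q ^ l)"
        using Suc k by simp
      moreover have "0 \<le> C * q ^ Suc m" using q C by simp
      ultimately show ?thesis by simp
    next
      case False
      then obtain k where k: "j = Suc (2 * k)" by (auto elim: oddE)
      have "T * real (2 * k) / 2 ^ Suc m = T * real k / 2 ^ m" by simp
      moreover have "\<bar>f (T * real k / 2 ^ m) - f 0\<bar> \<le> (\<Sum>l\<le>m. C * q ^ l)"
        using Suc k by simp
      moreover have "\<bar>f (T * real j / 2 ^ Suc m) - f (T * real (2 * k) / 2 ^ Suc m)\<bar> \<le> C * q ^ Suc m"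
        using Suc.prems k inc[of "2 * k" "Suc m"] by simp
      ultimately show ?thesis by simp
    qed
  qed
  have geo: "(\<Sum>l\<le>m. C * q ^ l) \<le> C / (1 - q)" for m
  proof -
    have "(\<Sum>l\<le>m. q ^ l) = (1 - q ^ Suc m) / (1 - q)"
      using q by (simp add: sum_gp0)
    also have "\<dots> \<le> 1 / (1 - q)" using q by (intro divide_right_mono) auto
    finally show ?thesis
      using C mult_left_mono[of _ "1 / (1 - q)" C] by (simp add: sum_distrib_left[symmetric])
  qed
  show ?thesis
  proof (cases "T = 0")
    case True
    with t q C show ?thesis by simp
  next
    case False
    with T have T: "0 < T" by simp
    \<comment> \<open>\<open>T * real (j m) / 2 ^ m\<close> is the last dyadic point of level m not
      after t, hence within T / 2^m of t.\<close>
    define j where "j m = nat \<lfloor>t / T * 2 ^ m\<rfloor>" for m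
    have j: "real (j m) \<le> t / T * 2 ^ m" "t / T * 2 ^ m \<le> real (j m) + 1" for m
    proof -
      have "0 \<le> t / T * 2 ^ m" using t T by simp
      then show "real (j m) \<le> t / T * 2 ^ m" "t / T * 2 ^ m \<le> real (j m) + 1"
        unfolding j_def by linarith+
    qed
    have "t / T * 2 ^ m \<le> 1 * 2 ^ m" for m
      using t T by (intro mult_right_mono) auto
    with j(1) have "real (j m) \<le> real (2 ^ m)" for m
      by (metis mult_1 of_nat_numeral of_nat_power order_trans)
    then have jle: "j m \<le> 2 ^ m" for m by (simp only: of_nat_le_iff)
    have bounds: "T * real (j m) / 2 ^ m \<le> t" "t - T / 2 ^ m \<le> T * real (j m) / 2 ^ m" for m
    proof -
      have "T * real (j m) \<le> t * 2 ^ m" "t * 2 ^ m \<le> T * real (j m) + T"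
        using j[of m] T by (simp_all add: field_simps)
      then show "T * real (j m) / 2 ^ m \<le> t" "t - T / 2 ^ m \<le> T * real (j m) / 2 ^ m"
        by (simp_all add: pos_divide_le_eq pos_le_divide_eq left_diff_distrib)
    qed
    have "(\<lambda>m. T * real (j m) / 2 ^ m) \<longlonglongrightarrow> t"
    proof (rule tendsto_sandwich)
      have "(\<lambda>m. t - T * inverse (2 ^ m)) \<longlonglongrightarrow> t - T * 0"
        by (intro tendsto_intros LIMSEQ_inverse_realpow_zero) simp
      then show "(\<lambda>m. t - T / 2 ^ m) \<longlonglongrightarrow> t" by (simp add: field_simps)
    qed (use bounds in auto)
    moreover have "T * real (j m) / 2 ^ m \<in> {0..T}" for m
      using bounds(1)[of m] t T by auto
    ultimately have "(\<lambda>m. f (T * real (j m) / 2 ^ m)) \<longlonglongrightarrow> f t"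
      using t by (intro continuous_on_tendsto_compose[OF cont]) auto
    then have "(\<lambda>m. \<bar>f (T * real (j m) / 2 ^ m) - f 0\<bar>) \<longlonglongrightarrow> \<bar>f t - f 0\<bar>"
      by (intro tendsto_intros)
    then show ?thesis
      using order_trans[OF dyadic[OF jle] geo] by (intro LIMSEQ_le_const2) auto
  qed
qed

text \<open>Convergence in mean gives almost sure convergence only along a subsequence; this carries
  the resulting limit of expectations back to the whole sequence.\<close>

lemma LIMSEQ_subsubsequence:
  fixes f :: "nat \<Rightarrow> 'b :: metric_space"
  assumes "\<And>r :: nat \<Rightarrow> nat. strict_mono r \<Longrightarrow> \<exists>r'. strict_mono r' \<and> (\<lambda>n. f (r (r' n))) \<longlonglongrightarrow> L"
  shows "f \<longlonglongrightarrow> L"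
proof (rule ccontr)
  assume "\<not> f \<longlonglongrightarrow> L"
  then obtain e where e: "0 < e" "\<not> (\<forall>\<^sub>F n in sequentially. dist (f n) L < e)"
    by (auto simp: tendsto_iff)
  obtain r :: "nat \<Rightarrow> nat" where r: "strict_mono r" "\<And>n. \<not> dist (f (r n)) L < e"
    using not_eventually_sequentiallyD[OF e(2)] by auto
  obtain r' where "(\<lambda>n. f (r (r' n))) \<longlonglongrightarrow> L"
    using assms[OF r(1)] by auto
  from tendstoD[OF this e(1)] have "\<forall>\<^sub>F n in sequentially. False"
    using r(2) by (auto elim!: eventually_mono)
  then show False by simp
qed

text \<open>Second moments would not do for chaining: 2^m increments of variance 2^-m add up to the
  same amount at every level. Fourth moments add up to order 2^-m.\<close>

lemma brownian_increment_fourth_moment: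
  assumes W: "standard_brownian_motion M W" and st: "0 \<le> s" "s < t"
  shows "(\<integral>\<^sup>+\<omega>. ennreal ((W t \<omega> - W s \<omega>) ^ 4) \<partial>M) = ennreal (3 * (t - s)\<^sup>2)"
proof -
  interpret prob_space M using W by (simp add: standard_brownian_motion_def)
  have D: "distributed M lborel (\<lambda>\<omega>. W t \<omega> - W s \<omega>) (normal_density 0 (sqrt (t - s)))"
    using W st by (simp add: standard_brownian_motion_def)
  have "0 < sqrt (t - s)" using st by simp
  from normal_distributed_nn_even_moment[OF this D, of 2] show ?thesis
    using st by (simp add: fact_numeral power_divide field_simps)
qed

text \<open>Chains on all intervals [0, k + 1] at once. Increments there scale like sqrt (k + 1) but
  are allowed to scale like k + 1, so their weighted fourth moments carry the factor (k + 1)^-2,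
  which is summable over k.\<close>

lemma brownian_linear_growth:
  assumes W: "standard_brownian_motion M W"
  shows "\<exists>H. (\<forall>\<omega>. 0 \<le> H \<omega>) \<and> integrable M (\<lambda>\<omega>. H \<omega> ^ 4) \<and>
    (AE \<omega> in M. \<forall>t\<ge>0. \<bar>W t \<omega>\<bar> \<le> H \<omega> * (1 + t))"
proof -
  interpret prob_space M using W by (simp add: standard_brownian_motion_def)
  have W_meas [measurable]: "W t \<in> borel_measurable M" if "0 \<le> t" for t
    using W that by (simp add: standard_brownian_motion_def)
  \<comment> \<open>Any \<open>q < 1\<close> with \<open>q ^ 4 > 1 / 2\<close> works: level \<open>m\<close> has \<open>2 ^ m\<close> increments with fourth
    moment of order \<open>4 ^ - m\<close>, so the terms of \<open>G\<close> decay like \<open>(1 / (2 * q ^ 4)) ^ m\<close>.\<close>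
  define q :: real where "q = 9 / 10"
  define inc where "inc k m j \<omega> = W (real (Suc k) * real (Suc j) / 2 ^ m) \<omega> - W (real (Suc k) * real j / 2 ^ m) \<omega>"
    for k m j \<omega>
  \<comment> \<open>The inverse fourth power of the size allowed at level m on [0, k + 1]: every
    increment is then at most \<open>G\<close> to the power 1/4 times that size.\<close>
  define w where "w k m = 1 / (real (Suc k) * q ^ m) ^ 4" for k m
  define G where "G \<omega> = (\<Sum>k. \<Sum>m. \<Sum>j<2^m. ennreal (w k m * inc k m j \<omega> ^ 4))" for \<omega>
  \<comment> \<open>The expectation of level m: 2^m increments of fourth moment 3 ((k + 1) / 2^m)^2,
    times the weight. The ratio 5000 / 6561 is 1 / (2 * q^4).\<close>
  define b where "b k m = 3 / (real (Suc k))\<^sup>2 * (5000 / 6561) ^ m" for k m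
  have inc_meas [measurable]: "inc k m j \<in> borel_measurable M" for k m j
    unfolding inc_def by (intro borel_measurable_diff W_meas) auto
  have w_nonneg: "0 \<le> w k m" for k m by (simp add: w_def q_def)
  have G_meas [measurable]: "G \<in> borel_measurable M" unfolding G_def by measurable
  have term_int: "(\<integral>\<^sup>+\<omega>. ennreal (w k m * inc k m j \<omega> ^ 4) \<partial>M)
      = ennreal (w k m * (3 * (real (Suc k) / 2 ^ m)\<^sup>2))" for k m j
  proof -
    have "real (Suc k) * real j / 2 ^ m < real (Suc k) * real (Suc j) / 2 ^ m"
      by (intro divide_strict_right_mono mult_strict_left_mono) auto
    from brownian_increment_fourth_moment[OF W _ this]
    have "(\<integral>\<^sup>+\<omega>. ennreal (inc k m j \<omega> ^ 4) \<partial>M)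
        = ennreal (3 * (real (Suc k) * real (Suc j) / 2 ^ m - real (Suc k) * real j / 2 ^ m)\<^sup>2)"
      unfolding inc_def by simp
    also have "real (Suc k) * real (Suc j) / 2 ^ m - real (Suc k) * real j / 2 ^ m = real (Suc k) / 2 ^ m"
      by (simp add: field_simps)
    finally have "(\<integral>\<^sup>+\<omega>. ennreal (inc k m j \<omega> ^ 4) \<partial>M) = ennreal (3 * (real (Suc k) / 2 ^ m)\<^sup>2)" .
    then show ?thesis
      using w_nonneg by (simp add: ennreal_mult' nn_integral_cmult)
  qed
  have level: "(\<Sum>j<(2::nat)^m. ennreal (w k m * (3 * (real (Suc k) / 2 ^ m)\<^sup>2))) = ennreal (b k m)" for k m
  proof -
    have "(\<Sum>j<(2::nat)^m. ennreal (w k m * (3 * (real (Suc k) / 2 ^ m)\<^sup>2)))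
        = ennreal (\<Sum>j<(2::nat)^m. w k m * (3 * (real (Suc k) / 2 ^ m)\<^sup>2))"
      by (rule sum_ennreal) (simp add: w_nonneg)
    also have "(\<Sum>j<(2::nat)^m. w k m * (3 * (real (Suc k) / 2 ^ m)\<^sup>2)) = b k m"
    proof -
      have "(q ^ m) ^ 4 = (6561 / 10000) ^ m"
        unfolding power_mult[symmetric] mult.commute[of m] by (simp add: power_mult q_def power_divide)
      moreover have "(2 ^ m)\<^sup>2 = (2 ^ m * 2 ^ m :: real)" by (simp add: power2_eq_square)
      moreover have "(5000 / 6561 :: real) ^ m = 1 / (2 ^ m * (6561 / 10000) ^ m)"
        by (simp add: power_mult_distrib[symmetric] power_one_over[symmetric])
      ultimately show ?thesis
        by (simp add: w_def b_def power_mult_distrib power_divide del: of_nat_Suc)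
           (simp add: field_simps eval_nat_numeral del: of_nat_Suc)
    qed
    finally show ?thesis .
  qed
  have "(\<integral>\<^sup>+\<omega>. G \<omega> \<partial>M) = (\<Sum>k. \<Sum>m. ennreal (b k m))"
    unfolding G_def by (simp add: nn_integral_suminf nn_integral_sum term_int level del: of_nat_Suc sum_constant)
  also have "\<dots> = (\<Sum>k. ennreal (3 / (real (Suc k))\<^sup>2 * (1 / (1 - 5000 / 6561))))"
    unfolding b_def
    by (intro arg_cong[where f=suminf] ext suminf_ennreal_eq sums_mult geometric_sums) auto
  also have "\<dots> \<noteq> \<infinity>"
  proof -
    have "summable (\<lambda>k. 3 / (real (Suc k))\<^sup>2 * (1 / (1 - 5000 / 6561)))"
      using inverse_power_summable[of 2, THEN summable_Suc_iff[THEN iffD2]]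
      by (intro summable_mult2) (simp add: divide_inverse summable_mult del: of_nat_Suc)
    then show ?thesis
      unfolding infinity_ennreal_def by (intro ennreal_suminf_neq_top) auto
  qed
  finally have fin: "(\<integral>\<^sup>+\<omega>. G \<omega> \<partial>M) \<noteq> \<infinity>" .
  \<comment> \<open>10 is 1 / (1 - q), the constant of the chaining bound. Where \<open>G\<close> is
    infinite, \<open>enn2real\<close> returns 0; this concerns only a null set.\<close>
  define H where "H \<omega> = 10 * root 4 (enn2real (G \<omega>))" for \<omega>
  have H_nonneg: "0 \<le> H \<omega>" for \<omega> by (simp add: H_def)
  have H4: "H \<omega> ^ 4 = 10000 * enn2real (G \<omega>)" for \<omega>
    by (simp add: H_def power_mult_distrib)
  have "(\<integral>\<^sup>+\<omega>. ennreal (enn2real (G \<omega>)) \<partial>M) \<le> (\<integral>\<^sup>+\<omega>. G \<omega> \<partial>M)"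
    by (intro nn_integral_mono) (simp add: ennreal_enn2real_if)
  then have "integrable M (\<lambda>\<omega>. enn2real (G \<omega>))"
    using fin by (intro integrableI_nonneg) (auto simp: less_top top.not_eq_extremum)
  then have H_int: "integrable M (\<lambda>\<omega>. H \<omega> ^ 4)"
    by (simp add: H4)
  have "AE \<omega> in M. G \<omega> \<noteq> \<infinity>"
    using fin by (intro nn_integral_PInf_AE) auto
  moreover have "AE \<omega> in M. W 0 \<omega> = 0"
    using W by (simp add: standard_brownian_motion_def)
  ultimately have "AE \<omega> in M. \<forall>t\<ge>0. \<bar>W t \<omega>\<bar> \<le> H \<omega> * (1 + t)"
    using AE_space
  proof eventually_elim
    case (elim \<omega>)
    let ?g = "enn2real (G \<omega>)"
    have cont: "continuous_on {0..} (\<lambda>t. W t \<omega>)"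
      using W elim(3) by (simp add: standard_brownian_motion_def)
    have inc_bound: "\<bar>inc k m j \<omega>\<bar> \<le> root 4 ?g * real (Suc k) * q ^ m" if "j < 2 ^ m" for k m j
    proof -
      have "ennreal (w k m * inc k m j \<omega> ^ 4) \<le> (\<Sum>j<2^m. ennreal (w k m * inc k m j \<omega> ^ 4))"
        using that by (intro member_le_sum) auto
      also have "\<dots> \<le> (\<Sum>m. \<Sum>j<2^m. ennreal (w k m * inc k m j \<omega> ^ 4))"
        using sum_le_suminf[OF summableI, of "{m}" "\<lambda>m. \<Sum>j<2^m. ennreal (w k m * inc k m j \<omega> ^ 4)"] by simp
      also have "\<dots> \<le> G \<omega>"
        unfolding G_def
        using sum_le_suminf[OF summableI, of "{k}" "\<lambda>k. \<Sum>m. \<Sum>j<2^m. ennreal (w k m * inc k m j \<omega> ^ 4)"] by simp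
      finally have "enn2real (ennreal (w k m * inc k m j \<omega> ^ 4)) \<le> ?g"
        using elim by (intro enn2real_mono) (auto simp: less_top)
      then have "w k m * inc k m j \<omega> ^ 4 \<le> ?g"
        using w_nonneg by (simp add: zero_le_even_power)
      then have "\<bar>inc k m j \<omega>\<bar> ^ 4 \<le> (root 4 ?g * real (Suc k) * q ^ m) ^ 4"
        by (simp add: w_def power_mult_distrib q_def field_simps del: of_nat_Suc)
      then show ?thesis
        by (rule power_le_imp_le_base[of _ 3, simplified]) (simp add: q_def)
    qed
    show ?case
    proof (intro allI impI)
      fix t :: real assume t: "0 \<le> t"
      \<comment> \<open>The interval [0, k + 1] contains t and has length at most 1 + t, so the
        factor k + 1 becomes linear growth in t.\<close>
      define k where "k = nat \<lfloor>t\<rfloor>"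
      have k: "t \<le> real (Suc k)" "real (Suc k) \<le> 1 + t"
        using t unfolding k_def by linarith+
      have "\<bar>W t \<omega> - W 0 \<omega>\<bar> \<le> root 4 ?g * real (Suc k) / (1 - q)"
      proof (rule dyadic_chaining[where f="\<lambda>t. W t \<omega>" and t=t and T="real (Suc k)"])
        show "continuous_on {0..real (Suc k)} (\<lambda>t. W t \<omega>)"
          by (rule continuous_on_subset[OF cont]) auto
        show "\<bar>W (real (Suc k) * real (Suc j) / 2 ^ m) \<omega> - W (real (Suc k) * real j / 2 ^ m) \<omega>\<bar>
            \<le> root 4 ?g * real (Suc k) * q ^ m" if "j < 2 ^ m" for m j
          using inc_bound[OF that] unfolding inc_def .
        show "t \<in> {0..real (Suc k)}" using t k by simp
        show "0 \<le> root 4 ?g * real (Suc k)" by simp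
      qed (simp_all add: q_def)
      also have "\<dots> = H \<omega> * real (Suc k)" by (simp add: H_def q_def)
      also have "\<dots> \<le> H \<omega> * (1 + t)" using k H_nonneg by (intro mult_left_mono)
      finally show "\<bar>W t \<omega>\<bar> \<le> H \<omega> * (1 + t)" using elim by simp
    qed
  qed
  with H_nonneg H_int show ?thesis by blast
qed

section \<open>Convergence of second moments along random times\<close>

text \<open>Applied to a nonnegative polynomial that vanishes at a, such as (x - a)^2, it turns
  convergence of moments into convergence in mean.\<close>

lemma tendsto_poly_of_moments:
  fixes X :: "nat \<Rightarrow> 'a \<Rightarrow> real" and p :: "real poly"
  assumes int: "\<And>N k. integrable M (\<lambda>\<omega>. X N \<omega> ^ k)"
    and lim: "\<And>k. (\<lambda>N. \<integral>\<omega>. X N \<omega> ^ k \<partial>M) \<longlonglongrightarrow> a ^ k"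
  shows "integrable M (\<lambda>\<omega>. poly p (X N \<omega>))"
    and "(\<lambda>N. \<integral>\<omega>. poly p (X N \<omega>) \<partial>M) \<longlonglongrightarrow> poly p a"
proof -
  show "integrable M (\<lambda>\<omega>. poly p (X N \<omega>))" for N
    unfolding poly_altdef by (intro Bochner_Integration.integrable_sum integrable_mult_right int)
  have "(\<lambda>N. \<Sum>k\<le>degree p. coeff p k * (\<integral>\<omega>. X N \<omega> ^ k \<partial>M)) \<longlonglongrightarrow> poly p a"
    unfolding poly_altdef by (intro tendsto_intros lim)
  then show "(\<lambda>N. \<integral>\<omega>. poly p (X N \<omega>) \<partial>M) \<longlonglongrightarrow> poly p a"
    by (simp add: poly_altdef int)
qed

lemma tendsto_floor_grid:
  assumes "0 \<le> a"
  shows "(\<lambda>N. real (nat \<lfloor>a * real (Suc N)\<rfloor>) / real (Suc N)) \<longlonglongrightarrow> a"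
proof (rule tendsto_sandwich)
  show "(\<lambda>N. a - inverse (real (Suc N))) \<longlonglongrightarrow> a"
    using tendsto_diff[OF tendsto_const LIMSEQ_inverse_real_of_nat, of a] by simp
  have fl: "real (nat \<lfloor>a * real (Suc N)\<rfloor>) \<le> a * real (Suc N) \<and> a * real (Suc N) - 1 \<le> real (nat \<lfloor>a * real (Suc N)\<rfloor>)" for N
  proof -
    have "0 \<le> a * real (Suc N)" using assms by simp
    then show ?thesis by linarith
  qed
  show "\<forall>\<^sub>F N in sequentially. a - inverse (real (Suc N)) \<le> real (nat \<lfloor>a * real (Suc N)\<rfloor>) / real (Suc N)"
    using fl by (intro always_eventually allI)
      (simp add: pos_le_divide_eq left_diff_distrib del: of_nat_Suc)
  show "\<forall>\<^sub>F N in sequentially. real (nat \<lfloor>a * real (Suc N)\<rfloor>) / real (Suc N) \<le> a"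
    using fl by (intro always_eventually allI) (simp add: pos_divide_le_eq del: of_nat_Suc)
qed simp

text \<open>The expected sum of squared steps when each squared step has mean c / (N + 1)^2: c = 1
  for the grid, c = 2 for exponential steps.\<close>

lemma tendsto_grid_mesh:
  assumes "0 \<le> a"
  shows "(\<lambda>N. real (nat \<lfloor>a * real (Suc N)\<rfloor>) * (c / (real (Suc N))\<^sup>2)) \<longlonglongrightarrow> 0"
proof -
  have "(\<lambda>N. real (nat \<lfloor>a * real (Suc N)\<rfloor>) / real (Suc N) * (c * inverse (real (Suc N)))) \<longlonglongrightarrow> a * (c * 0)"
    by (intro tendsto_intros tendsto_floor_grid LIMSEQ_inverse_real_of_nat assms)
  moreover have "real (nat \<lfloor>a * real (Suc N)\<rfloor>) / real (Suc N) * (c * inverse (real (Suc N)))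
      = real (nat \<lfloor>a * real (Suc N)\<rfloor>) * (c / (real (Suc N))\<^sup>2)" for N
    by (simp add: field_simps power2_eq_square del: of_nat_Suc)
  ultimately show ?thesis by simp
qed

text \<open>Grid sums are measurable and converge at every sample point, which settles the
  measurability of the path integral.\<close>

lemma borel_measurable_partition_limit:
  assumes W: "standard_brownian_motion M W" and a: "0 \<le> a"
  shows "(\<lambda>\<omega>. a * W a \<omega> - integral {0..a} (\<lambda>t. W t \<omega>)) \<in> borel_measurable M"
proof (rule borel_measurable_LIMSEQ_real)
  let ?n = "\<lambda>N. nat \<lfloor>a * real (Suc N)\<rfloor>" and ?s = "\<lambda>N i. real i / real (Suc N)"
  show "(\<lambda>\<omega>. \<Sum>i<?n N. ?s N (Suc i) * (W (?s N (Suc i)) \<omega> - W (?s N i) \<omega>)) \<in> borel_measurable M" for N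
    using W by (intro borel_measurable_sum borel_measurable_times borel_measurable_diff)
      (auto simp: standard_brownian_motion_def simp del: of_nat_Suc)
  fix \<omega> assume "\<omega> \<in> space M"
  then have "continuous_on {0..} (\<lambda>t. W t \<omega>)"
    using W by (simp add: standard_brownian_motion_def)
  then show "(\<lambda>N. \<Sum>i<?n N. ?s N (Suc i) * (W (?s N (Suc i)) \<omega> - W (?s N i) \<omega>))
      \<longlonglongrightarrow> a * W a \<omega> - integral {0..a} (\<lambda>t. W t \<omega>)"
  proof (rule integration_by_parts_partition_limit)
    show "(\<lambda>N. ?s N (?n N)) \<longlonglongrightarrow> a" by (rule tendsto_floor_grid[OF a])
    show "(\<lambda>N. \<Sum>i<?n N. (?s N (Suc i) - ?s N i)\<^sup>2) \<longlonglongrightarrow> 0"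
      using tendsto_grid_mesh[OF a, of 1]
      by (simp add: diff_divide_distrib[symmetric] power_divide)
  qed (auto simp: divide_right_mono)
qed

text \<open>Times for different N are unrelated, so end point and mesh are controlled in mean, and
  almost sure statements about the times concern one N at a time. No integrable bound common to all
  N is at hand, hence the truncation in the proof.\<close>

lemma sampled_second_moment_limit:
  fixes s :: "nat \<Rightarrow> nat \<Rightarrow> 'a \<Rightarrow> real"
  assumes W: "standard_brownian_motion M W" and a: "0 \<le> a"
    and meas: "\<And>N i. i \<le> n N \<Longrightarrow> s N i \<in> borel_measurable M"
    and nonneg: "\<And>N i \<omega>. i \<le> n N \<Longrightarrow> \<omega> \<in> space M \<Longrightarrow> 0 \<le> s N i \<omega>"
    and mono: "\<And>N. AE \<omega> in M. s N 0 \<omega> = 0 \<and> (\<forall>i<n N. s N i \<omega> \<le> s N (Suc i) \<omega>)"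
    and end_int: "\<And>N k. integrable M (\<lambda>\<omega>. s N (n N) \<omega> ^ k)"
    and end_lim: "\<And>k. (\<lambda>N. \<integral>\<omega>. s N (n N) \<omega> ^ k \<partial>M) \<longlonglongrightarrow> a ^ k"
    and mesh_int: "\<And>N. integrable M (\<lambda>\<omega>. \<Sum>i<n N. (s N (Suc i) \<omega> - s N i \<omega>)\<^sup>2)"
    and mesh_lim: "(\<lambda>N. \<integral>\<omega>. (\<Sum>i<n N. (s N (Suc i) \<omega> - s N i \<omega>)\<^sup>2) \<partial>M) \<longlonglongrightarrow> 0"
  shows "(\<lambda>N. \<integral>\<omega>. (\<Sum>i<n N. s N (Suc i) \<omega> * (W (s N (Suc i) \<omega>) \<omega> - W (s N i \<omega>) \<omega>))\<^sup>2 \<partial>M)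
    \<longlonglongrightarrow> (\<integral>\<omega>. (a * W a \<omega> - integral {0..a} (\<lambda>t. W t \<omega>))\<^sup>2 \<partial>M)"
proof -
  interpret prob_space M using W by (simp add: standard_brownian_motion_def)
  have cont: "continuous_on {0..} (\<lambda>t. W t \<omega>)" if "\<omega> \<in> space M" for \<omega>
    using W that by (simp add: standard_brownian_motion_def)
  obtain H where "\<forall>\<omega>. 0 \<le> H \<omega>" and H: "integrable M (\<lambda>\<omega>. H \<omega> ^ 4)"
    "AE \<omega> in M. \<forall>t\<ge>0. \<bar>W t \<omega>\<bar> \<le> H \<omega> * (1 + t)"
    using brownian_linear_growth[OF W] by blast
  then have H_nonneg: "0 \<le> H \<omega>" for \<omega> by simp
  define X where "X N \<omega> = (\<Sum>i<n N. s N (Suc i) \<omega> * (W (s N (Suc i) \<omega>) \<omega> - W (s N i \<omega>) \<omega>))" for N \<omega>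
  define Z where "Z \<omega> = a * W a \<omega> - integral {0..a} (\<lambda>t. W t \<omega>)" for \<omega>
  \<comment> \<open>The square of x^2 (1 + x)^2, the factor that remains in the bound of the squared
    sum beside H^2.\<close>
  define P where "P x = x ^ 4 * (1 + x) ^ 4" for x :: real
  \<comment> \<open>It vanishes at a. The first square drives the end point to a in L^2, the second
    bounds the excess of \<open>P\<close> at the end point over \<open>P a\<close>.\<close>
  define p where "p = [:- a, 1:]\<^sup>2 + ([:0, 1:] ^ 4 * [:1, 1:] ^ 4 - [:P a:])\<^sup>2"
  define V where "V N \<omega> = (\<Sum>i<n N. (s N (Suc i) \<omega> - s N i \<omega>)\<^sup>2)" for N \<omega>
  define U where "U N \<omega> = poly p (s N (n N) \<omega>) + V N \<omega>" for N \<omega>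
  \<comment> \<open>Here \<open>X\<^sup>2 \<le> 2 * H ^ 4 + 2 * P \<tau>\<^sub>n\<close> and \<open>P \<tau>\<^sub>n \<le> P a + 1 + (P \<tau>\<^sub>n - P a)\<^sup>2\<close>, so \<open>X\<^sup>2\<close> exceeds
    the integrable \<open>K\<close> by at most \<open>2 * U\<close>, which vanishes in mean: \<open>X\<^sup>2\<close> may be truncated at \<open>K\<close>.\<close>
  define K where "K \<omega> = 2 * H \<omega> ^ 4 + 2 * P a + 2" for \<omega>
  define Y where "Y N \<omega> = min ((X N \<omega>)\<^sup>2) (K \<omega>)" for N \<omega>
  have p: "poly p x = (x - a)\<^sup>2 + (P x - P a)\<^sup>2" for x
    by (simp add: p_def P_def)
  have V_nonneg: "0 \<le> V N \<omega>" for N \<omega>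
    unfolding V_def by (intro sum_nonneg) simp
  have U_nonneg: "0 \<le> U N \<omega>" for N \<omega>
    using V_nonneg[of N \<omega>] by (simp add: U_def p)
  have K_nonneg: "0 \<le> K \<omega>" for \<omega>
    using a by (simp add: K_def P_def zero_le_even_power)
  have V_int: "integrable M (V N)" for N unfolding V_def by (rule mesh_int)
  have U_int: "integrable M (U N)" for N
    unfolding U_def by (intro Bochner_Integration.integrable_add tendsto_poly_of_moments(1)[OF end_int end_lim] V_int)
  have K_int: "integrable M K"
    unfolding K_def using H(1) by auto
  have "(\<lambda>N. (\<integral>\<omega>. poly p (s N (n N) \<omega>) \<partial>M) + (\<integral>\<omega>. V N \<omega> \<partial>M)) \<longlonglongrightarrow> poly p a + 0"
    unfolding V_def by (intro tendsto_add tendsto_poly_of_moments(2)[OF end_int end_lim] mesh_lim)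
  moreover have "(\<integral>\<omega>. U N \<omega> \<partial>M) = (\<integral>\<omega>. poly p (s N (n N) \<omega>) \<partial>M) + (\<integral>\<omega>. V N \<omega> \<partial>M)" for N
    unfolding U_def by (intro Bochner_Integration.integral_add tendsto_poly_of_moments(1)[OF end_int end_lim] V_int)
  ultimately have U_lim: "(\<lambda>N. \<integral>\<omega>. U N \<omega> \<partial>M) \<longlonglongrightarrow> 0"
    by (simp add: p)
  have W_at: "(\<lambda>\<omega>. W (s N i \<omega>) \<omega>) \<in> borel_measurable M" if i: "i \<le> n N" for N i
  proof -
    have "(\<lambda>(\<omega>, t). W (max 0 t) \<omega>) \<in> borel_measurable (M \<Otimes>\<^sub>M borel)"
      using W by (intro borel_measurable_continuous_process) (auto simp: standard_brownian_motion_def)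
    from measurable_compose[OF measurable_Pair[OF measurable_ident meas[OF i]] this]
    have "(\<lambda>\<omega>. W (max 0 (s N i \<omega>)) \<omega>) \<in> borel_measurable M" by simp
    then show ?thesis
      by (rule measurable_cong[THEN iffD1, rotated]) (simp add: nonneg[OF i] max_absorb2)
  qed
  have X_meas: "X N \<in> borel_measurable M" for N
    unfolding X_def by (intro borel_measurable_sum borel_measurable_times borel_measurable_diff W_at meas) auto
  have Z_meas: "Z \<in> borel_measurable M"
    unfolding Z_def by (rule borel_measurable_partition_limit[OF W a])
  have bound: "AE \<omega> in M. (X N \<omega>)\<^sup>2 \<le> K \<omega> + 2 * U N \<omega>" for N
    using H(2) mono[of N]
  proof eventually_elim
    case (elim \<omega>)
    let ?t = "s N (n N) \<omega>"
    have "\<bar>X N \<omega>\<bar> \<le> 2 * H \<omega> * ?t * (1 + ?t)"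
      unfolding X_def by (rule partition_sum_bound[of "\<lambda>i. s N i \<omega>"]) (use elim H_nonneg in auto)
    then have "(X N \<omega>)\<^sup>2 \<le> (2 * H \<omega> * ?t * (1 + ?t))\<^sup>2"
      by (rule abs_le_square_iff[THEN iffD1, OF order_trans]) simp
    also have "\<dots> = 2 * (2 * (H \<omega>)\<^sup>2 * (?t\<^sup>2 * (1 + ?t)\<^sup>2))"
      by (simp add: power_mult_distrib)
    also have "\<dots> \<le> 2 * (((H \<omega>)\<^sup>2)\<^sup>2 + (?t\<^sup>2 * (1 + ?t)\<^sup>2)\<^sup>2)"
      by (intro mult_left_mono sum_squares_bound) simp
    also have "\<dots> = 2 * H \<omega> ^ 4 + 2 * P ?t"
      by (simp add: P_def power_mult_distrib power_mult[symmetric])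
    also have "P ?t \<le> P a + 1 + (P ?t - P a)\<^sup>2"
      using sum_squares_bound[of "P ?t - P a" 1] by (simp add: power2_eq_square)
        (smt (verit) mult_le_cancel_left1 zero_le_square)
    also have "(P ?t - P a)\<^sup>2 \<le> U N \<omega>"
      using V_nonneg[of N \<omega>] by (simp add: U_def p)
    finally show ?case by (simp add: K_def)
  qed
  have X2_int: "integrable M (\<lambda>\<omega>. (X N \<omega>)\<^sup>2)" for N
  proof (rule Bochner_Integration.integrable_bound)
    show "integrable M (\<lambda>\<omega>. K \<omega> + 2 * U N \<omega>)" using K_int U_int by auto
    show "AE \<omega> in M. norm ((X N \<omega>)\<^sup>2) \<le> norm (K \<omega> + 2 * U N \<omega>)"
      using bound[of N] by eventually_elim auto
  qed (use X_meas in simp)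
  have Y_int: "integrable M (Y N)" for N
    unfolding Y_def by (intro integrable_min X2_int K_int)
  have diff: "(\<lambda>N. (\<integral>\<omega>. (X N \<omega>)\<^sup>2 \<partial>M) - (\<integral>\<omega>. Y N \<omega> \<partial>M)) \<longlonglongrightarrow> 0"
  proof (rule tendsto_sandwich[OF always_eventually always_eventually tendsto_const])
    have "(\<integral>\<omega>. (X N \<omega>)\<^sup>2 \<partial>M) \<le> (\<integral>\<omega>. Y N \<omega> + 2 * U N \<omega> \<partial>M)" for N
    proof (rule integral_mono_AE)
      show "AE \<omega> in M. (X N \<omega>)\<^sup>2 \<le> Y N \<omega> + 2 * U N \<omega>"
        using bound[of N]
      proof eventually_elim
        case (elim \<omega>)
        with U_nonneg[of N \<omega>] show ?case by (auto simp: Y_def min_def)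
      qed
    qed (use X2_int Y_int U_int in auto)
    then show "\<forall>N. (\<integral>\<omega>. (X N \<omega>)\<^sup>2 \<partial>M) - (\<integral>\<omega>. Y N \<omega> \<partial>M) \<le> 2 * (\<integral>\<omega>. U N \<omega> \<partial>M)"
      using Y_int U_int by (simp add: algebra_simps)
    show "\<forall>N. 0 \<le> (\<integral>\<omega>. (X N \<omega>)\<^sup>2 \<partial>M) - (\<integral>\<omega>. Y N \<omega> \<partial>M)"
      using integral_mono[OF Y_int X2_int] by (simp only: diff_ge_0_iff_ge) (simp add: Y_def)
    show "(\<lambda>N. 2 * (\<integral>\<omega>. U N \<omega> \<partial>M)) \<longlonglongrightarrow> 0"
      using tendsto_mult_right_zero[OF U_lim] .
  qed
  have Y_lim: "(\<lambda>N. \<integral>\<omega>. Y N \<omega> \<partial>M) \<longlonglongrightarrow> (\<integral>\<omega>. (Z \<omega>)\<^sup>2 \<partial>M)"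
  proof (rule LIMSEQ_subsubsequence)
    fix r :: "nat \<Rightarrow> nat" assume r: "strict_mono r"
    have "(\<lambda>N. \<integral>\<omega>. norm (U (r N) \<omega>) \<partial>M) \<longlonglongrightarrow> 0"
      using LIMSEQ_subseq_LIMSEQ[OF U_lim r] U_nonneg by (simp add: comp_def)
    then obtain r' where r': "strict_mono r'" "AE \<omega> in M. (\<lambda>N. U (r (r' N)) \<omega>) \<longlonglongrightarrow> 0"
      using tendsto_L1_AE_subseq[of M "\<lambda>N. U (r N)"] U_int by auto
    let ?q = "\<lambda>N. r (r' N)"
    have "(\<lambda>N. \<integral>\<omega>. Y (?q N) \<omega> \<partial>M) \<longlonglongrightarrow> (\<integral>\<omega>. (Z \<omega>)\<^sup>2 \<partial>M)"
    proof (rule integral_dominated_convergence)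
      have "AE \<omega> in M. \<forall>N. (X (?q N) \<omega>)\<^sup>2 \<le> K \<omega> + 2 * U (?q N) \<omega>"
        "AE \<omega> in M. \<forall>N. s (?q N) 0 \<omega> = 0 \<and> (\<forall>i<n (?q N). s (?q N) i \<omega> \<le> s (?q N) (Suc i) \<omega>)"
        unfolding AE_all_countable using bound mono by blast+
      then show "AE \<omega> in M. (\<lambda>N. Y (?q N) \<omega>) \<longlonglongrightarrow> (Z \<omega>)\<^sup>2"
        using r'(2) AE_space
      proof eventually_elim
        case (elim \<omega>)
        \<comment> \<open>\<open>U\<close> is a sum of nonnegative terms, so its convergence to 0
          forces the mesh to 0 and the end point to a.\<close>
        have V0: "(\<lambda>N. V (?q N) \<omega>) \<longlonglongrightarrow> 0"
          by (rule tendsto_sandwich[OF _ _ tendsto_const elim(3)])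
             (auto simp: V_nonneg U_def p intro!: always_eventually)
        have "(\<lambda>N. (s (?q N) (n (?q N)) \<omega> - a)\<^sup>2) \<longlonglongrightarrow> 0"
          by (rule tendsto_sandwich[OF _ _ tendsto_const elim(3)])
             (auto simp: V_nonneg U_def p intro!: always_eventually add_increasing2)
        then have "(\<lambda>N. s (?q N) (n (?q N)) \<omega>) \<longlonglongrightarrow> a"
          by (simp add: power_tendsto_0_iff LIM_zero_iff)
        with V0 have "(\<lambda>N. X (?q N) \<omega>) \<longlonglongrightarrow> Z \<omega>"
          unfolding X_def Z_def V_def
          by (intro integration_by_parts_partition_limit cont) (use elim in auto)
        then have X2: "(\<lambda>N. (X (?q N) \<omega>)\<^sup>2) \<longlonglongrightarrow> (Z \<omega>)\<^sup>2"
          by (intro tendsto_intros)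
        \<comment> \<open>Passing to the limit in the bound puts \<open>(Z \<omega>)\<^sup>2\<close>
          below \<open>K \<omega>\<close>, so the truncation disappears in the limit.\<close>
        have "(\<lambda>N. K \<omega> + 2 * U (?q N) \<omega>) \<longlonglongrightarrow> K \<omega> + 2 * 0"
          by (intro tendsto_intros elim)
        then have "(Z \<omega>)\<^sup>2 \<le> K \<omega>"
          using LIMSEQ_le[OF X2] elim(1) by auto
        with tendsto_min[OF X2 tendsto_const[of "K \<omega>"]] show ?case
          by (simp add: Y_def min_absorb1)
      qed
      show "AE \<omega> in M. norm (Y (?q N) \<omega>) \<le> K \<omega>" for N
        using K_nonneg by (auto simp: Y_def)
    qed (use K_int Y_int Z_meas in auto)
    with r' show "\<exists>r'. strict_mono r' \<and> (\<lambda>N. \<integral>\<omega>. Y (r (r' N)) \<omega> \<partial>M) \<longlonglongrightarrow> (\<integral>\<omega>. (Z \<omega>)\<^sup>2 \<partial>M)"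
      by blast
  qed
  from tendsto_add[OF diff Y_lim] show ?thesis
    by (simp add: X_def Z_def)
qed

lemma brownian_limit_second_moment:
  assumes W: "standard_brownian_motion M W" and a: "0 \<le> a"
  shows "(\<integral>\<omega>. (a * W a \<omega> - integral {0..a} (\<lambda>t. W t \<omega>))\<^sup>2 \<partial>M) = 1 / 3 * a ^ 3"
proof (rule LIMSEQ_unique)
  interpret prob_space M using W by (simp add: standard_brownian_motion_def)
  define n where "n N = nat \<lfloor>a * real (Suc N)\<rfloor>" for N
  define s where "s N i = real i / real (Suc N)" for N i
  let ?X = "\<lambda>N \<omega>. (\<Sum>i<n N. s N (Suc i) * (W (s N (Suc i)) \<omega> - W (s N i) \<omega>))\<^sup>2"
  have s_step: "s N (Suc i) - s N i = 1 / real (Suc N)" for N i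
    by (simp add: s_def diff_divide_distrib[symmetric])
  have s_le: "s N i \<le> s N (Suc i)" "0 \<le> s N i" "0 < s N (Suc i)" for N i
    by (simp_all add: s_def divide_right_mono)
  have n_lim: "(\<lambda>N. s N (n N)) \<longlonglongrightarrow> a"
    unfolding s_def n_def by (rule tendsto_floor_grid[OF a])
  show "(\<lambda>N. \<integral>\<omega>. ?X N \<omega> \<partial>M) \<longlonglongrightarrow> (\<integral>\<omega>. (a * W a \<omega> - integral {0..a} (\<lambda>t. W t \<omega>))\<^sup>2 \<partial>M)"
  proof (rule sampled_second_moment_limit[OF W a])
    show "(\<lambda>N. \<integral>\<omega>. s N (n N) ^ k \<partial>M) \<longlonglongrightarrow> a ^ k" for k
      using tendsto_power[OF n_lim, of k] by (simp add: prob_space)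
    show "(\<lambda>N. \<integral>\<omega>. (\<Sum>i<n N. (s N (Suc i) - s N i)\<^sup>2) \<partial>M) \<longlonglongrightarrow> 0"
      using tendsto_grid_mesh[OF a, of 1] by (simp add: s_step n_def prob_space power_divide)
  qed (use s_le in \<open>auto simp: s_def\<close>)
  have W_meas: "W (s N i) \<in> borel_measurable M" for N i
    using W s_le by (simp add: standard_brownian_motion_def)
  \<comment> \<open>With x the last grid point and h = 1 / (N + 1), the formula for sums of squares
    becomes x (x + h) (2x + h) / 6, where x tends to a and h to 0.\<close>
  have "(\<integral>\<omega>. ?X N \<omega> \<partial>M) = s N (n N) * (s N (n N) + inverse (real (Suc N))) * (2 * s N (n N) + inverse (real (Suc N))) / 6" for N
  proof -
    have "(\<integral>\<omega>. ?X N \<omega> \<partial>M) = enn2real (\<integral>\<^sup>+\<omega>. ennreal (?X N \<omega>) \<partial>M)"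
      by (intro integral_eq_nn_integral borel_measurable_power borel_measurable_sum borel_measurable_times
          borel_measurable_diff W_meas) auto
    also have "(\<integral>\<^sup>+\<omega>. ennreal (?X N \<omega>) \<partial>M) = ennreal (\<Sum>i<n N. (s N (Suc i))\<^sup>2 * (s N (Suc i) - s N i))"
      using s_le by (intro brownian_weighted_increments_second_moment[OF W])
        (auto simp: s_def divide_strict_right_mono)
    also have "enn2real \<dots> = (\<Sum>i<n N. (s N (Suc i))\<^sup>2 * (s N (Suc i) - s N i))"
      using s_le by (intro enn2real_ennreal sum_nonneg) simp
    also have "\<dots> = (\<Sum>i<n N. (real (Suc i))\<^sup>2) / real (Suc N) ^ 3"
      unfolding s_step sum_divide_distrib
      by (intro sum.cong) (simp_all add: s_def power_divide power2_eq_square power3_eq_cube del: of_nat_Suc)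
    also have "(\<Sum>i<m. (real (Suc i))\<^sup>2) = real m * (real m + 1) * (2 * real m + 1) / 6" for m
      by (induction m) (simp_all add: power2_eq_square field_simps)
    also have "real (n N) * (real (n N) + 1) * (2 * real (n N) + 1) / 6 / real (Suc N) ^ 3
        = s N (n N) * (s N (n N) + inverse (real (Suc N))) * (2 * s N (n N) + inverse (real (Suc N))) / 6"
      by (simp add: s_def field_simps power3_eq_cube del: of_nat_Suc)
    finally show ?thesis .
  qed
  moreover have "(\<lambda>N. s N (n N) * (s N (n N) + inverse (real (Suc N))) * (2 * s N (n N) + inverse (real (Suc N))) / 6)
      \<longlonglongrightarrow> a * (a + 0) * (2 * a + 0) / 6"
    by (intro tendsto_intros n_lim LIMSEQ_inverse_real_of_nat) simp
  ultimately show "(\<lambda>N. \<integral>\<omega>. ?X N \<omega> \<partial>M) \<longlonglongrightarrow> 1 / 3 * a ^ 3"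
    by (simp add: power3_eq_cube field_simps)
qed

section \<open>Jittered sampling\<close>

text \<open>A density fixes only the law of the jitter, so its support bounds the jitter almost
  surely; finitely many indices share one null set.\<close>

lemma jittered_sampling_AE:
  assumes M: "prob_space M" and J: "jittered_sampling M W \<tau>" and N: "1 \<le> N"
  shows "AE \<omega> in M. \<tau> N 0 \<omega> = 0 \<and> (\<forall>i\<in>{1..N}. \<bar>\<tau> N i \<omega> - real i / real N\<bar> \<le> 1 / (2 * real N))"
proof -
  interpret prob_space M by (rule M)
  have \<tau>0: "\<forall>\<omega>\<in>space M. \<tau> N 0 \<omega> = 0"
    using J N unfolding jittered_sampling_def by (elim exE conjE) simp
  have "\<exists>(\<nu> :: nat \<Rightarrow> 'a \<Rightarrow> real) (g :: real \<Rightarrow> real).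
      (\<forall>x. x \<notin> {- 1 / (2 * real N) .. 1 / (2 * real N)} \<longrightarrow> g x = 0) \<and>
      (\<forall>i\<in>{1..N}. distributed M lborel (\<nu> i) (\<lambda>x. ennreal (g x)) \<and>
        (\<forall>\<omega>\<in>space M. \<tau> N i \<omega> = real i / real N + \<nu> i \<omega>))"
    using J N unfolding jittered_sampling_def
    by - (elim exE conjE, drule_tac x=N in spec, drule (1) mp, elim exE conjE,
      rule_tac x=\<nu> in exI, rule_tac x=g in exI, simp)
  then obtain \<nu> :: "nat \<Rightarrow> 'a \<Rightarrow> real" and g where
    g0: "\<And>x. x \<notin> {- 1 / (2 * real N) .. 1 / (2 * real N)} \<Longrightarrow> g x = 0"
    and D: "\<And>i. i \<in> {1..N} \<Longrightarrow> distributed M lborel (\<nu> i) (\<lambda>x. ennreal (g x))"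
    and \<tau>: "\<And>i \<omega>. i \<in> {1..N} \<Longrightarrow> \<omega> \<in> space M \<Longrightarrow> \<tau> N i \<omega> = real i / real N + \<nu> i \<omega>"
    by blast
  have "AE \<omega> in M. \<bar>\<nu> i \<omega>\<bar> \<le> 1 / (2 * real N)" if "i \<in> {1..N}" for i
  proof (subst distributed_AE2[OF D[OF that]])
    have "0 < ennreal (g x) \<Longrightarrow> \<bar>x\<bar> \<le> 1 / (2 * real N)" for x
      using g0[of x] by (cases "x \<in> {- 1 / (2 * real N) .. 1 / (2 * real N)}") auto
    then show "AE x in lborel. 0 < ennreal (g x) \<longrightarrow> \<bar>x\<bar> \<le> 1 / (2 * real N)" by simp
  qed simp
  then have "AE \<omega> in M. \<forall>i\<in>{1..N}. \<bar>\<nu> i \<omega>\<bar> \<le> 1 / (2 * real N)"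
    by (simp add: AE_finite_all)
  then show ?thesis using AE_space
    by eventually_elim (use \<tau> \<tau>0 in auto)
qed

lemma jittered_second_moment_limit:
  assumes W: "standard_brownian_motion M W" and J: "jittered_sampling M W \<tau>"
  defines "s N \<equiv> \<tau> (Suc N)"
  shows "(\<lambda>N. \<integral>\<omega>. (\<Sum>i<Suc N. s N (Suc i) \<omega> * (W (s N (Suc i) \<omega>) \<omega> - W (s N i \<omega>) \<omega>))\<^sup>2 \<partial>M) \<longlonglongrightarrow> 1 / 3"
proof -
  interpret prob_space M using W by (simp add: standard_brownian_motion_def)
  \<comment> \<open>Half the grid spacing and the bound on the jitter. Grid points are 2d apart and
    each moves by at most d, so the order survives and no step exceeds 4d.\<close>
  define d where "d N = 1 / (2 * real (Suc N))" for N
  have d: "0 < d N" "d N \<le> 1 / 2" "real i / real (Suc N) = 2 * real i * d N" "2 * real (Suc N) * d N = 1" for N i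
    by (simp_all add: d_def field_simps)
  have d_lim: "d \<longlonglongrightarrow> 0"
    using tendsto_mult_right_zero[OF LIMSEQ_inverse_real_of_nat, of "1 / 2"]
    by (simp add: d_def[abs_def] field_simps)
  have close: "AE \<omega> in M. s N 0 \<omega> = 0 \<and> (\<forall>i\<in>{1..Suc N}. \<bar>s N i \<omega> - 2 * real i * d N\<bar> \<le> d N)" for N
    using jittered_sampling_AE[OF prob_space_axioms J, of "Suc N"] unfolding s_def d(3)
    by (simp add: d_def del: of_nat_Suc)
  have times: "s N i \<in> borel_measurable M" "\<And>\<omega>. \<omega> \<in> space M \<Longrightarrow> 0 \<le> s N i \<omega>" if "i \<le> Suc N" for N i
  proof -
    have "independent_random_times M W {..Suc N} (\<tau> (Suc N))"
      using J unfolding jittered_sampling_def by (elim exE conjE) simp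
    then show "s N i \<in> borel_measurable M" "\<And>\<omega>. \<omega> \<in> space M \<Longrightarrow> 0 \<le> s N i \<omega>"
      using that by (simp_all add: independent_random_times_def s_def)
  qed
  have step: "AE \<omega> in M. \<forall>i<Suc N. 0 \<le> s N (Suc i) \<omega> - s N i \<omega> \<and> s N (Suc i) \<omega> - s N i \<omega> \<le> 4 * d N" for N
    using close[of N]
  proof (eventually_elim, intro allI impI)
    fix \<omega> i assume c: "s N 0 \<omega> = 0 \<and> (\<forall>i\<in>{1..Suc N}. \<bar>s N i \<omega> - 2 * real i * d N\<bar> \<le> d N)" and i: "i < Suc N"
    then have 1: "\<bar>s N (Suc i) \<omega> - 2 * real (Suc i) * d N\<bar> \<le> d N"
      by (auto simp del: of_nat_Suc)
    show "0 \<le> s N (Suc i) \<omega> - s N i \<omega> \<and> s N (Suc i) \<omega> - s N i \<omega> \<le> 4 * d N"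
    \<comment> \<open>The time with index 0 is exactly 0 and the jitter bound starts at index 1, so
      the first step is treated apart.\<close>
    proof (cases i)
      case 0
      with 1 c d(1)[of N] show ?thesis by (simp add: abs_le_iff)
    next
      case (Suc m)
      then have "\<bar>s N i \<omega> - 2 * real i * d N\<bar> \<le> d N"
        using c i by (auto simp del: of_nat_Suc)
      with 1 show ?thesis by (auto simp: abs_le_iff algebra_simps)
    qed
  qed
  have end_close: "AE \<omega> in M. 1 - d N \<le> s N (Suc N) \<omega> \<and> s N (Suc N) \<omega> \<le> 1 + d N" for N
    using close[of N] by eventually_elim (use d(4)[of N] in \<open>auto simp: abs_le_iff dest!: bspec[of _ _ "Suc N"]\<close>)
  have end_pow: "AE \<omega> in M. (1 - d N) ^ k \<le> s N (Suc N) \<omega> ^ k \<and> s N (Suc N) \<omega> ^ k \<le> (1 + d N) ^ k" for N k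
    using end_close[of N] by eventually_elim (use d(1,2)[of N] in \<open>auto intro!: power_mono\<close>)
  have end_int: "integrable M (\<lambda>\<omega>. s N (Suc N) \<omega> ^ k)" for N k
  proof (rule integrable_const_bound)
    show "AE \<omega> in M. norm (s N (Suc N) \<omega> ^ k) \<le> (1 + d N) ^ k"
      using end_pow[of N k] AE_space
      by eventually_elim (use times(2)[of "Suc N" N] in auto)
  qed (use times in simp)
  have mesh_bound: "AE \<omega> in M. (\<Sum>i<Suc N. (s N (Suc i) \<omega> - s N i \<omega>)\<^sup>2) \<le> 8 * d N" for N
    using step[of N]
  proof eventually_elim
    case (elim \<omega>)
    have "(\<Sum>i<Suc N. (s N (Suc i) \<omega> - s N i \<omega>)\<^sup>2) \<le> (\<Sum>i<Suc N. (4 * d N)\<^sup>2)"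
      using elim by (intro sum_mono power_mono) auto
    \<comment> \<open>There are N + 1 steps and (N + 1) d = 1 / 2, so one factor d survives.\<close>
    also have "\<dots> = 8 * d N * (2 * real (Suc N) * d N)" by (simp add: power2_eq_square)
    finally show ?case unfolding d(4) by simp
  qed
  have mesh_int: "integrable M (\<lambda>\<omega>. \<Sum>i<Suc N. (s N (Suc i) \<omega> - s N i \<omega>)\<^sup>2)" for N
  proof (rule integrable_const_bound)
    show "AE \<omega> in M. norm (\<Sum>i<Suc N. (s N (Suc i) \<omega> - s N i \<omega>)\<^sup>2) \<le> 8 * d N"
      using mesh_bound[of N] by eventually_elim (simp add: sum_nonneg del: sum.lessThan_Suc)
  qed (intro borel_measurable_sum borel_measurable_power borel_measurable_diff times, auto)
  have "(\<lambda>N. \<integral>\<omega>. (\<Sum>i<Suc N. s N (Suc i) \<omega> * (W (s N (Suc i) \<omega>) \<omega> - W (s N i \<omega>) \<omega>))\<^sup>2 \<partial>M)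
      \<longlonglongrightarrow> (\<integral>\<omega>. (1 * W 1 \<omega> - integral {0..1} (\<lambda>t. W t \<omega>))\<^sup>2 \<partial>M)"
  proof (rule sampled_second_moment_limit[OF W])
    show "AE \<omega> in M. s N 0 \<omega> = 0 \<and> (\<forall>i<Suc N. s N i \<omega> \<le> s N (Suc i) \<omega>)" for N
      using close[of N] step[of N] by eventually_elim auto
    show "(\<lambda>N. \<integral>\<omega>. s N (Suc N) \<omega> ^ k \<partial>M) \<longlonglongrightarrow> 1 ^ k" for k
    proof (rule tendsto_sandwich[OF always_eventually always_eventually])
      show "\<forall>N. (1 - d N) ^ k \<le> (\<integral>\<omega>. s N (Suc N) \<omega> ^ k \<partial>M)"
        using end_pow[of _ k] by (intro allI integral_ge_const end_int) auto
      show "\<forall>N. (\<integral>\<omega>. s N (Suc N) \<omega> ^ k \<partial>M) \<le> (1 + d N) ^ k"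
        using end_pow[of _ k] by (intro allI integral_le_const end_int) auto
      have "(\<lambda>N. (1 - d N) ^ k) \<longlonglongrightarrow> (1 - 0) ^ k" "(\<lambda>N. (1 + d N) ^ k) \<longlonglongrightarrow> (1 + 0) ^ k"
        by (intro tendsto_intros d_lim)+
      then show "(\<lambda>N. (1 - d N) ^ k) \<longlonglongrightarrow> 1 ^ k" "(\<lambda>N. (1 + d N) ^ k) \<longlonglongrightarrow> 1 ^ k" by simp_all
    qed
    show "(\<lambda>N. \<integral>\<omega>. (\<Sum>i<Suc N. (s N (Suc i) \<omega> - s N i \<omega>)\<^sup>2) \<partial>M) \<longlonglongrightarrow> 0"
    proof (rule tendsto_sandwich[OF always_eventually always_eventually tendsto_const])
      show "\<forall>N. 0 \<le> (\<integral>\<omega>. (\<Sum>i<Suc N. (s N (Suc i) \<omega> - s N i \<omega>)\<^sup>2) \<partial>M)"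
        by (intro allI integral_nonneg_AE AE_I2 sum_nonneg) simp
      show "\<forall>N. (\<integral>\<omega>. (\<Sum>i<Suc N. (s N (Suc i) \<omega> - s N i \<omega>)\<^sup>2) \<partial>M) \<le> 8 * d N"
        by (intro allI integral_le_const mesh_int mesh_bound)
      show "(\<lambda>N. 8 * d N) \<longlonglongrightarrow> 0" by (rule tendsto_mult_right_zero[OF d_lim])
    qed
  qed (use times end_int mesh_int in auto)
  then show ?thesis
    by (simp only: brownian_limit_second_moment[OF W zero_le_one] power_one mult_1_right)
qed

section \<open>Renewal sampling\<close>

lemma fact_eq_fact_mult_prod: "fact (m + k) = (fact m * (\<Prod>j<k. real (Suc m + j)) :: real)"
  by (induction k) (simp_all add: algebra_simps)

text \<open>The sum has an Erlang law, whose k-th moment is the rising factorial n (n + 1) ... (n +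
  k - 1) divided by l^k.\<close>

lemma (in prob_space) exponential_sum_moment:
  assumes l: "0 < l" and indep: "indep_vars (\<lambda>_. borel) t {1..n}"
    and D: "\<And>j. j \<in> {1..n} \<Longrightarrow> distributed M lborel (t j) (\<lambda>x. ennreal (exponential_density l x))"
  shows "has_bochner_integral M (\<lambda>\<omega>. (\<Sum>j=1..n. t j \<omega>) ^ k) (\<Prod>j<k. (real n + real j) / l)"
proof (cases n)
  case 0
  \<comment> \<open>An empty sum has no Erlang law. For k = 0 both sides are 1; for k > 0 the factor
    j = 0 makes the product vanish.\<close>
  have "(\<Prod>j<k. real j / l) = 0 ^ k"
    by (cases k) (simp_all add: prod.lessThan_Suc_shift del: prod.lessThan_Suc)
  with 0 show ?thesis
    by (simp add: has_bochner_integral_iff prob_space)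
next
  case (Suc m)
  have "distributed M lborel (\<lambda>\<omega>. \<Sum>j=1..n. t j \<omega>) (erlang_density ((\<Sum>j=1..n. Suc 0) - 1) l)"
    using l indep D Suc by (intro erlang_distributed_sum) auto
  then have "distributed M lborel (\<lambda>\<omega>. \<Sum>j=1..n. t j \<omega>) (erlang_density m l)"
    using Suc by simp
  from has_bochner_integral_erlang_ith_moment[OF l this, of k]
  show ?thesis
    using Suc by (simp add: fact_eq_fact_mult_prod prod_dividef add.assoc)
qed

lemma renewal_second_moment_limit:
  assumes W: "standard_brownian_motion M W" and R: "renewal_sampling M W \<tau>" and a: "0 \<le> a"
  defines "s N \<equiv> \<tau> (Suc N)" and "n N \<equiv> nat \<lfloor>a * real (Suc N)\<rfloor>"
  shows "(\<lambda>N. \<integral>\<omega>. (\<Sum>i<n N. s N (Suc i) \<omega> * (W (s N (Suc i) \<omega>) \<omega> - W (s N i \<omega>) \<omega>))\<^sup>2 \<partial>M)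
    \<longlonglongrightarrow> 1 / 3 * a ^ 3"
proof -
  interpret prob_space M using W by (simp add: standard_brownian_motion_def)
  have "\<forall>N. \<exists>t. indep_vars (\<lambda>_. borel) t {1..} \<and>
      (\<forall>j\<ge>1. distributed M lborel (t j) (\<lambda>x. ennreal (exponential_density (real (Suc N)) x))) \<and>
      (\<forall>i. \<forall>\<omega>\<in>space M. s N i \<omega> = (\<Sum>j=1..i. t j \<omega>))"
    using R unfolding renewal_sampling_def s_def by (intro allI, drule_tac x="Suc N" in spec) simp
  from choice[OF this] obtain t where t: "\<forall>N. indep_vars (\<lambda>_. borel) (t N) {1..} \<and>
      (\<forall>j\<ge>1. distributed M lborel (t N j) (\<lambda>x. ennreal (exponential_density (real (Suc N)) x))) \<and>
      (\<forall>i. \<forall>\<omega>\<in>space M. s N i \<omega> = (\<Sum>j=1..i. t N j \<omega>))" ..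
  then have indep: "\<And>N. indep_vars (\<lambda>_. borel) (t N) {1..}"
    and D: "\<And>N j. 1 \<le> j \<Longrightarrow> distributed M lborel (t N j) (\<lambda>x. ennreal (exponential_density (real (Suc N)) x))"
    and s: "\<And>N i \<omega>. \<omega> \<in> space M \<Longrightarrow> s N i \<omega> = (\<Sum>j=1..i. t N j \<omega>)"
    by blast+
  have times: "s N i \<in> borel_measurable M" "\<And>\<omega>. \<omega> \<in> space M \<Longrightarrow> 0 \<le> s N i \<omega>" for N i
  proof -
    have "independent_random_times M W UNIV (\<tau> (Suc N))"
      using R unfolding renewal_sampling_def by simp
    then show "s N i \<in> borel_measurable M" "\<And>\<omega>. \<omega> \<in> space M \<Longrightarrow> 0 \<le> s N i \<omega>"
      by (simp_all add: independent_random_times_def s_def)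
  qed
  have step: "s N (Suc i) \<omega> - s N i \<omega> = t N (Suc i) \<omega>" if "\<omega> \<in> space M" for N i \<omega>
    using that by (simp add: s)
  have pos: "AE \<omega> in M. \<forall>i. 0 \<le> t N (Suc i) \<omega>" for N
    unfolding AE_all_countable
    by (intro allI, subst distributed_AE2[OF D]) (auto simp: exponential_density_def)
  have end_moment: "has_bochner_integral M (\<lambda>\<omega>. s N (n N) \<omega> ^ k) (\<Prod>j<k. (real (n N) + real j) / real (Suc N))" for N k
    using exponential_sum_moment[OF _ indep_vars_subset[OF indep] D, of N "n N" k]
    by (subst has_bochner_integral_cong[OF refl _ refl]) (auto simp: s simp del: of_nat_Suc)
  have step2: "has_bochner_integral M (\<lambda>\<omega>. (s N (Suc i) \<omega> - s N i \<omega>)\<^sup>2) (2 / (real (Suc N))\<^sup>2)" for N i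
  proof -
    \<comment> \<open>The exponential density is \<open>erlang_density 0\<close>, with second moment
      2! over the squared rate.\<close>
    have "has_bochner_integral M (\<lambda>\<omega>. (t N (Suc i) \<omega>)\<^sup>2) (fact (0 + 2) / (fact 0 * (real (Suc N))\<^sup>2))"
      by (intro has_bochner_integral_erlang_ith_moment D) auto
    then show ?thesis
      by (subst has_bochner_integral_cong[OF refl _ refl])
         (auto simp: step simp del: of_nat_Suc simp flip: numeral_2_eq_2)
  qed
  have mesh: "has_bochner_integral M (\<lambda>\<omega>. \<Sum>i<n N. (s N (Suc i) \<omega> - s N i \<omega>)\<^sup>2)
      (real (n N) * (2 / (real (Suc N))\<^sup>2))" for N
    using has_bochner_integral_sum[of "{..<n N}" M "\<lambda>i \<omega>. (s N (Suc i) \<omega> - s N i \<omega>)\<^sup>2", OF step2] by simp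
  show ?thesis
    unfolding brownian_limit_second_moment[OF W a, symmetric]
  proof (rule sampled_second_moment_limit[OF W a])
    show "AE \<omega> in M. s N 0 \<omega> = 0 \<and> (\<forall>i<n N. s N i \<omega> \<le> s N (Suc i) \<omega>)" for N
      using pos[of N] AE_space
    proof eventually_elim
      case (elim \<omega>)
      then show ?case using step[of \<omega> N] by (simp add: s[of \<omega>])
    qed
    show "(\<lambda>N. \<integral>\<omega>. s N (n N) \<omega> ^ k \<partial>M) \<longlonglongrightarrow> a ^ k" for k
    proof -
      \<comment> \<open>The number k of factors is fixed and each shift j / (N + 1) vanishes, so
        every factor tends to a.\<close>
      have "(\<lambda>N. \<Prod>j<k. real (n N) / real (Suc N) + real j * inverse (real (Suc N))) \<longlonglongrightarrow> (\<Prod>j<k. a + real j * 0)"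
        unfolding n_def by (intro tendsto_intros tendsto_floor_grid a LIMSEQ_inverse_real_of_nat)
      then show ?thesis
        using end_moment
        by (simp add: has_bochner_integral_iff add_divide_distrib divide_inverse distrib_right del: of_nat_Suc)
    qed
    show "(\<lambda>N. \<integral>\<omega>. (\<Sum>i<n N. (s N (Suc i) \<omega> - s N i \<omega>)\<^sup>2) \<partial>M) \<longlonglongrightarrow> 0"
      using mesh tendsto_grid_mesh[OF a, of 2] by (simp add: has_bochner_integral_iff n_def del: of_nat_Suc)
  qed (use times end_moment mesh in \<open>auto simp: has_bochner_integral_iff\<close>)
qed

theorem lemma1:
  fixes M :: "'a measure"
    and W :: "real \<Rightarrow> 'a \<Rightarrow> real"
    and \<tau> :: "nat \<Rightarrow> nat \<Rightarrow> 'a \<Rightarrow> real"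
    and \<alpha> :: real
  assumes "standard_brownian_motion M W"
    and "jittered_sampling M W \<tau> \<and> \<alpha> = 1 \<or>
         renewal_sampling M W \<tau> \<and> 0 < \<alpha> \<and> \<alpha> < 1"
  shows "(\<lambda>N. prob_space.expectation M (\<lambda>\<omega>. \<bar>real N * sampled_sum W \<tau> \<alpha> N \<omega>\<bar>\<^sup>2))
           \<longlonglongrightarrow> 1 / 3 * \<alpha> ^ 3"
proof -
  \<comment> \<open>The sampling conditions start at N = 1, so the limit is taken along N + 1, where
    N + 1 also cancels the prefactor of \<open>sampled_sum\<close>, and shifted back at the
    end.\<close>
  have "(\<lambda>N. \<integral>\<omega>. (\<Sum>i<nat \<lfloor>\<alpha> * real (Suc N)\<rfloor>. \<tau> (Suc N) (Suc i) \<omega>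
      * (W (\<tau> (Suc N) (Suc i) \<omega>) \<omega> - W (\<tau> (Suc N) i \<omega>) \<omega>))\<^sup>2 \<partial>M) \<longlonglongrightarrow> 1 / 3 * \<alpha> ^ 3"
    using assms(2)
  proof
    assume J: "jittered_sampling M W \<tau> \<and> \<alpha> = 1"
    have "nat \<lfloor>\<alpha> * real (Suc N)\<rfloor> = Suc N" for N
      using J by (simp del: of_nat_Suc)
    with jittered_second_moment_limit[OF assms(1)] J show ?thesis
      by (simp del: of_nat_Suc sum.lessThan_Suc)
  next
    assume "renewal_sampling M W \<tau> \<and> 0 < \<alpha> \<and> \<alpha> < 1"
    then show ?thesis
      using renewal_second_moment_limit[OF assms(1)] by simp
  qed
  moreover have "\<bar>real (Suc N) * sampled_sum W \<tau> \<alpha> (Suc N) \<omega>\<bar>\<^sup>2 = (\<Sum>i<nat \<lfloor>\<alpha> * real (Suc N)\<rfloor>.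
      \<tau> (Suc N) (Suc i) \<omega> * (W (\<tau> (Suc N) (Suc i) \<omega>) \<omega> - W (\<tau> (Suc N) i \<omega>) \<omega>))\<^sup>2" for N \<omega>
    by (simp add: sampled_sum_def del: of_nat_Suc)
  ultimately have "(\<lambda>N. \<integral>\<omega>. \<bar>real (Suc N) * sampled_sum W \<tau> \<alpha> (Suc N) \<omega>\<bar>\<^sup>2 \<partial>M) \<longlonglongrightarrow> 1 / 3 * \<alpha> ^ 3"
    by simp
  then show ?thesis by (rule LIMSEQ_imp_Suc)
qed

end
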